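(* Let $G$ be an $r$-regular connected graph of order $n\geq2$ with $m$ edges. If all the signless Laplacian eigenvalues of $G$ are integers, then $\mathcal{Q}(G)$ has no signless Laplacian perfect state transfer (i.e., there are no two distinct vertices $u,v$ of $\mathcal{Q}(G)$ and time $t\in\mathbb{R}$ with $\exp(-itQ_{\mathcal{Q}(G)})e_u=\lambda e_v$ for some $\lambda$ with $|\lambda|=1$).
   Context: For a graph $H$, $Q_H=D(H)+A(H)$ is the signless Laplacian matrix (diagonal degree matrix plus adjacency matrix), and its eigenvalues are the signless Laplacian eigenvalues of $H$. $e_u$ is the characteristic vector of vertex $u$. The $\mathcal{Q}$-graph $\mathcal{Q}(G)$ is obtained from $G$ by inserting a new vertex into each edge of $G$ (adjacent to both endpoints of that edge, the original edge being replaced) and joining two new vertices by an edge whenever the corresponding edges of $G$ share an endpoint. *)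

theory Defs
  imports
    Complex_Main
    "Graph_Theory.Graph_Theory"
    "Jordan_Normal_Form.Char_Poly"
begin

text \<open>
  A finite simple undirected graph is a \<^locale>\<open>pair_graph\<close>: a finite, loop-free digraph without
  parallel arcs whose arc relation is symmetric. An undirected edge therefore corresponds to two
  opposite arcs, and the degree of a vertex is its out-degree.
\<close>

definition edges :: "'a pair_pre_digraph \<Rightarrow> 'a set set" where
  "edges G = {{u, v} | u v. (u, v) \<in> parcs G}"

definition regular :: "nat \<Rightarrow> 'a pair_pre_digraph \<Rightarrow> bool" where
  "regular r G \<longleftrightarrow> (\<forall>u \<in> pverts G. out_degree (with_proj G) u = r)"

text \<open>\<open>Inl u\<close> is the old vertex \<open>u\<close>; \<open>Inr e\<close> is the new vertex inserted into the edge \<open>e\<close>.\<close>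

definition Q_graph :: "'a pair_pre_digraph \<Rightarrow> ('a + 'a set) pair_pre_digraph" where
  "Q_graph G = \<lparr>
     pverts = pverts G <+> edges G,
     parcs = {(Inl u, Inr e) | u e. e \<in> edges G \<and> u \<in> e}
           \<union> {(Inr e, Inl u) | u e. e \<in> edges G \<and> u \<in> e}
           \<union> {(Inr e, Inr f) | e f. e \<in> edges G \<and> f \<in> edges G \<and> e \<noteq> f \<and> e \<inter> f \<noteq> {}}\<rparr>"

lemma pair_graph_Q_graph:
  assumes "pair_graph G"
  shows "pair_graph (Q_graph G)"
proof -
  interpret G: pair_graph G by fact
  have sub: "edges G \<subseteq> Pow (pverts G)"
    by (auto simp: edges_def dest: G.in_arcsD1 G.in_arcsD2)
  have fE: "finite (edges G)"
    using sub G.pair_finite_verts by (meson finite_Pow_iff finite_subset)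
  have fV: "finite (pverts (Q_graph G))"
    using fE G.pair_finite_verts by (simp add: Q_graph_def)
  have wf: "parcs (Q_graph G) \<subseteq> pverts (Q_graph G) \<times> pverts (Q_graph G)"
    using sub by (auto simp: Q_graph_def)
  have fA: "finite (parcs (Q_graph G))"
    using wf fV by (meson finite_SigmaI finite_subset)
  have sy: "symmetric (with_proj (Q_graph G))"
    unfolding symmetric_def with_proj_simps by (rule symI) (auto simp: Q_graph_def)
  show ?thesis
  proof
    show "fst e \<in> pverts (Q_graph G)" if "e \<in> parcs (Q_graph G)" for e
      using that wf by auto
    show "snd e \<in> pverts (Q_graph G)" if "e \<in> parcs (Q_graph G)" for e
      using that wf by auto
    show "fst e \<noteq> snd e" if "e \<in> parcs (Q_graph G)" for e
      using that by (auto simp: Q_graph_def)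
  qed (fact fV fA sy)+
qed

text \<open>
  Matrices of the library are indexed by \<open>{0..<n}\<close>, so the vertices are listed in an arbitrary but
  fixed order. Another order changes the matrices below only by a simultaneous permutation of rows
  and columns, under which eigenvalues and perfect state transfer are invariant.
\<close>

definition vertex_list :: "'a pair_pre_digraph \<Rightarrow> 'a list" where
  "vertex_list G = (SOME vs. distinct vs \<and> set vs = pverts G)"

lemma vertex_list:
  assumes "finite (pverts G)"
  shows "distinct (vertex_list G)" and "set (vertex_list G) = pverts G"
proof -
  have "\<exists>vs. distinct vs \<and> set vs = pverts G"
    using finite_distinct_list[OF assms] by blast
  then have "distinct (vertex_list G) \<and> set (vertex_list G) = pverts G"
    unfolding vertex_list_def by (rule someI_ex)
  then show "distinct (vertex_list G)" and "set (vertex_list G) = pverts G"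
    by auto
qed

definition adjacency_mat :: "'a pair_pre_digraph \<Rightarrow> complex mat" where
  "adjacency_mat G = mat (card (pverts G)) (card (pverts G))
     (\<lambda>(i, j). of_bool ((vertex_list G ! i, vertex_list G ! j) \<in> parcs G))"

definition degree_mat :: "'a pair_pre_digraph \<Rightarrow> complex mat" where
  "degree_mat G = mat (card (pverts G)) (card (pverts G))
     (\<lambda>(i, j). if i = j then of_nat (out_degree (with_proj G) (vertex_list G ! i)) else 0)"

definition signless_laplacian :: "'a pair_pre_digraph \<Rightarrow> complex mat" where
  "signless_laplacian G = degree_mat G + adjacency_mat G"

definition char_vec :: "'a pair_pre_digraph \<Rightarrow> 'a \<Rightarrow> complex vec" where
  "char_vec G u = vec (card (pverts G)) (\<lambda>i. of_bool (vertex_list G ! i = u))"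

text \<open>
  The matrix exponential \<open>\<Sum>k. A\<^sup>k / k!\<close> of a square matrix, as an entrywise series; it always
  converges, see \<open>summable_mat_exp\<close>.
\<close>

definition mat_exp :: "complex mat \<Rightarrow> complex mat" where
  "mat_exp A = mat (dim_row A) (dim_row A) (\<lambda>(i, j). \<Sum>k. (A ^\<^sub>m k) $$ (i, j) / fact k)"

lemma summable_mat_exp:
  fixes A :: "complex mat"
  assumes A: "A \<in> carrier_mat n n" and ij: "i < n" "j < n"
  shows "summable (\<lambda>k. (A ^\<^sub>m k) $$ (i, j) / fact k)"
proof -
  define C where "C = (\<Sum>i<n. \<Sum>j<n. cmod (A $$ (i, j)))"
  have C: "cmod (A $$ (a, b)) \<le> C" if "a < n" "b < n" for a b
  proof -
    have "cmod (A $$ (a, b)) \<le> (\<Sum>j<n. cmod (A $$ (a, j)))"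
      using that by (intro member_le_sum) auto
    also have "\<dots> \<le> C"
      unfolding C_def using that
      by (intro member_le_sum[where f = "\<lambda>i. \<Sum>j<n. cmod (A $$ (i, j))"]) (auto intro: sum_nonneg)
    finally show ?thesis .
  qed
  have C0: "C \<ge> 0" unfolding C_def by (intro sum_nonneg) auto
  have bound: "cmod ((A ^\<^sub>m k) $$ (a, b)) \<le> (real n * C) ^ k" if "a < n" "b < n" for a b k
    using that
  proof (induction k arbitrary: a b)
    case 0
    then show ?case using A by auto
  next
    case (Suc k)
    have Ak: "A ^\<^sub>m k \<in> carrier_mat n n" using A by (rule pow_carrier_mat)
    have "(A ^\<^sub>m Suc k) $$ (a, b) = (\<Sum>c<n. (A ^\<^sub>m k) $$ (a, c) * A $$ (c, b))"
      using A Ak Suc.prems by (auto simp: scalar_prod_def atLeast0LessThan intro!: sum.cong)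
    also have "cmod \<dots> \<le> (\<Sum>c<n. (real n * C) ^ k * C)"
      using Suc C C0 by (intro sum_norm_le) (auto simp: norm_mult intro!: mult_mono)
    also have "\<dots> = (real n * C) ^ Suc k" by simp
    finally show ?case .
  qed
  show ?thesis
  proof (rule summable_comparison_test')
    show "summable (\<lambda>k. inverse (fact k) * (real n * C) ^ k)"
      by (rule summable_exp)
    show "norm ((A ^\<^sub>m k) $$ (i, j) / fact k) \<le> inverse (fact k) * (real n * C) ^ k"
      if "k \<ge> 0" for k
      using bound[OF ij, of k] by (simp add: norm_divide divide_simps)
  qed
qed

definition signless_laplacian_PST :: "'a pair_pre_digraph \<Rightarrow> 'a \<Rightarrow> 'a \<Rightarrow> bool" where
  "signless_laplacian_PST G u v \<longleftrightarrow>
     (\<exists>(t::real) (z::complex). cmod z = 1 \<and>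
        mat_exp ((- \<i> * complex_of_real t) \<cdot>\<^sub>m signless_laplacian G) *\<^sub>v char_vec G u = z \<cdot>\<^sub>v char_vec G v)"

definition has_signless_laplacian_PST :: "'a pair_pre_digraph \<Rightarrow> bool" where
  "has_signless_laplacian_PST G \<longleftrightarrow>
     (\<exists>u \<in> pverts G. \<exists>v \<in> pverts G. u \<noteq> v \<and> signless_laplacian_PST G u v)"

end

theory Submission
  imports Defs
begin

text \<open>
  Write \<open>R\<close> for the incidence matrix of \<open>G\<close>, \<open>H\<close> for the signless Laplacian of \<open>\<Q>(G)\<close> and suppose
  \<open>exp(-itH) e\<^sub>u = z e\<^sub>v\<close>. Any two eigenvalues \<open>\<theta>, \<tau>\<close> of \<open>H\<close> with eigenvectors not vanishing at \<open>u\<close>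
  satisfy \<open>t (\<theta> - \<tau>) \<in> \<pi>\<int>\<close>. An eigenvector \<open>x\<close> of \<open>R R\<^sup>T\<close> with eigenvalue \<open>\<mu> \<noteq> 0\<close> lifts to the
  eigenvectors \<open>(x, b R\<^sup>T x)\<close> of \<open>H\<close> for the two roots \<open>b\<close> of a quadratic, and the two eigenvalues add
  up to \<open>3r - 2 + \<mu>\<close>. For \<open>x = 1\<close>, \<open>\<mu> = 2r\<close> they are \<open>\<theta>\<^sub>+, \<theta>\<^sub>- = (5r - 2 \<plusminus> sqrt(9r\<^sup>2 - 4r + 4)) / 2\<close>, irrational
  if \<open>r \<ge> 2\<close>, and their eigenvectors vanish nowhere. So if the lifts of an integer \<open>\<mu>\<close> are seen at
  \<open>u\<close>, the integer \<open>2(5r - 2) - 2(3r - 2 + \<mu>)\<close> is a rational multiple of \<open>\<theta>\<^sub>+ - \<theta>\<^sub>-\<close>, whence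
  \<open>\<mu> = 2r\<close>; the exceptional eigenvalues \<open>r\<close> and \<open>2r - 2\<close> belonging to \<open>\<mu> = 0\<close> are excluded in the
  same way. But \<open>e\<^sub>u\<close> is not an eigenvector of \<open>R R\<^sup>T\<close> or \<open>R\<^sup>T R\<close> for \<open>2r\<close>, so some \<open>\<mu> \<noteq> 2r\<close> is seen
  at \<open>u\<close>. For \<open>r = 1\<close>, where \<open>\<Q>(G)\<close> is a union of paths with three vertices and \<open>\<theta>\<^sub>+, \<theta>\<^sub>-\<close> are
  integers, explicit eigenvectors decide.
\<close>

section \<open>Eigenfunctions of symmetric kernels\<close>

text \<open>A real matrix indexed by the elements of \<open>V\<close> themselves, so that vertices
  and edges are treated alike. The entries are real so that the operator commutes with
  conjugation.\<close>

definition kernel_op :: "'a set \<Rightarrow> ('a \<Rightarrow> 'a \<Rightarrow> real) \<Rightarrow> ('a \<Rightarrow> complex) \<Rightarrow> 'a \<Rightarrow> complex" where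
  "kernel_op V K f v = (\<Sum>w\<in>V. of_real (K v w) * f w)"

definition poly_op ::
  "'a set \<Rightarrow> ('a \<Rightarrow> 'a \<Rightarrow> real) \<Rightarrow> complex poly \<Rightarrow> ('a \<Rightarrow> complex) \<Rightarrow> 'a \<Rightarrow> complex" where
  "poly_op V K p f v = (\<Sum>k\<le>degree p. coeff p k * (kernel_op V K ^^ k) f v)"

lemma kernel_op_cong: "(\<And>w. w \<in> V \<Longrightarrow> f w = g w) \<Longrightarrow> kernel_op V K f = kernel_op V K g"
  by (auto simp: kernel_op_def intro!: sum.cong)

lemma kernel_op_scale: "kernel_op V K (\<lambda>w. c * f w) = (\<lambda>v. c * kernel_op V K f v)"
  by (auto simp: kernel_op_def sum_distrib_left algebra_simps)

lemma kernel_op_add: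
  "kernel_op V K (\<lambda>w. f w + g w) = (\<lambda>v. kernel_op V K f v + kernel_op V K g v)"
  by (auto simp: kernel_op_def sum.distrib algebra_simps)

lemma kernel_op_0: "kernel_op V K (\<lambda>w. 0) = (\<lambda>v. 0)"
  by (auto simp: kernel_op_def)

lemma kernel_op_sum:
  "kernel_op V K (\<lambda>w. \<Sum>i\<in>A. f i w) = (\<lambda>v. \<Sum>i\<in>A. kernel_op V K (f i) v)"
  by (induction A rule: infinite_finite_induct) (simp_all add: kernel_op_add kernel_op_0)

lemma kernel_op_cnj: "kernel_op V K (\<lambda>w. cnj (f w)) v = cnj (kernel_op V K f v)"
  by (simp add: kernel_op_def)

lemma kernel_op_symmetric:
  assumes "\<And>v w. K v w = K w v"
  shows "(\<Sum>v\<in>V. kernel_op V K f v * g v) = (\<Sum>v\<in>V. f v * kernel_op V K g v)"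
proof -
  have "(\<Sum>v\<in>V. kernel_op V K f v * g v) = (\<Sum>v\<in>V. \<Sum>w\<in>V. of_real (K v w) * f w * g v)"
    by (simp add: kernel_op_def sum_distrib_right)
  also have "\<dots> = (\<Sum>w\<in>V. \<Sum>v\<in>V. of_real (K v w) * f w * g v)"
    by (rule sum.swap)
  also have "\<dots> = (\<Sum>w\<in>V. f w * kernel_op V K g w)"
    unfolding kernel_op_def sum_distrib_left
    by (intro sum.cong refl) (metis assms mult.assoc mult.commute)
  finally show ?thesis .
qed

lemma poly_op_eq_sum:
  assumes "degree p \<le> N"
  shows "poly_op V K p f v = (\<Sum>k\<le>N. coeff p k * (kernel_op V K ^^ k) f v)"
  unfolding poly_op_def using assms
  by (intro sum.mono_neutral_left) (auto simp: coeff_eq_0)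

lemma poly_op_0: "poly_op V K 0 f v = 0"
  by (simp add: poly_op_def)

lemma poly_op_pCons:
  "poly_op V K (pCons a p) f = (\<lambda>v. a * f v + kernel_op V K (poly_op V K p f) v)"
proof
  fix v
  have "poly_op V K (pCons a p) f v
      = (\<Sum>k\<le>Suc (degree p). coeff (pCons a p) k * (kernel_op V K ^^ k) f v)"
    by (rule poly_op_eq_sum) (rule degree_pCons_le)
  also have "\<dots> = a * f v + (\<Sum>k\<le>degree p. coeff p k * kernel_op V K ((kernel_op V K ^^ k) f) v)"
    by (subst sum.atMost_Suc_shift) simp
  also have "(\<Sum>k\<le>degree p. coeff p k * kernel_op V K ((kernel_op V K ^^ k) f) v)
      = kernel_op V K (poly_op V K p f) v"
    unfolding poly_op_def by (simp add: kernel_op_sum kernel_op_scale)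
  finally show "poly_op V K (pCons a p) f v = a * f v + kernel_op V K (poly_op V K p f) v" .
qed

lemma poly_op_smult: "poly_op V K (Polynomial.smult c p) f v = c * poly_op V K p f v"
  by (cases "c = 0") (simp_all add: poly_op_def sum_distrib_left algebra_simps)

lemma poly_op_add: "poly_op V K (p + q) f v = poly_op V K p f v + poly_op V K q f v"
proof -
  let ?N = "max (degree p) (degree q)"
  show ?thesis
    using poly_op_eq_sum[of "p + q" ?N V K f v] poly_op_eq_sum[of p ?N V K f v]
      poly_op_eq_sum[of q ?N V K f v]
    by (simp add: degree_add_le_max sum.distrib distrib_right)
qed

lemma poly_op_linear_factor:
  "poly_op V K ([:-\<mu>, 1:] * q) f v = kernel_op V K (poly_op V K q f) v - \<mu> * poly_op V K q f v"
proof -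
  have "[:-\<mu>, 1:] * q = Polynomial.smult (-\<mu>) q + pCons 0 q"
    by simp
  then show ?thesis
    by (simp only: poly_op_add poly_op_smult poly_op_pCons) simp
qed

lemma poly_op_cnj:
  assumes "\<And>v. cnj (f v) = f v"
  shows "cnj (poly_op V K p f v) = poly_op V K (map_poly cnj p) f v"
proof (induction p arbitrary: v)
  case 0
  then show ?case by (simp add: poly_op_0)
next
  case (pCons a p)
  have "poly_op V K (map_poly cnj p) f = (\<lambda>w. cnj (poly_op V K p f w))"
    by (simp add: pCons.IH)
  then have "kernel_op V K (poly_op V K (map_poly cnj p) f) v = cnj (kernel_op V K (poly_op V K p f) v)"
    by (simp only: kernel_op_cnj)
  then show ?case
    by (simp add: Polynomial.map_poly_pCons[where f = cnj] poly_op_pCons assms)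
qed

text \<open>The pairing is bilinear, so \<open>p\<close> moves across without conjugated
  coefficients. Where a norm is wanted, the conjugate is put in explicitly.\<close>

lemma poly_op_symmetric:
  assumes "\<And>v w. K v w = K w v"
  shows "(\<Sum>v\<in>V. poly_op V K p f v * g v) = (\<Sum>v\<in>V. f v * poly_op V K p g v)"
proof (induction p arbitrary: f g)
  case 0
  then show ?case by (simp add: poly_op_0)
next
  case (pCons a p)
  have "(\<Sum>v\<in>V. kernel_op V K (poly_op V K p f) v * g v)
      = (\<Sum>v\<in>V. f v * poly_op V K p (kernel_op V K g) v)"
    by (simp only: kernel_op_symmetric[OF assms] pCons.IH)
  also have "poly_op V K p (kernel_op V K g) = kernel_op V K (poly_op V K p g)"
    unfolding poly_op_def[abs_def] by (simp add: kernel_op_sum kernel_op_scale funpow_swap1)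
  finally show ?case
    by (simp add: poly_op_pCons distrib_left distrib_right sum.distrib mult.assoc mult.left_commute)
qed

lemma poly_op_eigen:
  assumes "\<And>v. v \<in> V \<Longrightarrow> kernel_op V K f v = \<mu> * f v" and "v \<in> V"
  shows "poly_op V K p f v = poly p \<mu> * f v"
  using assms(2)
proof (induction p arbitrary: v)
  case 0
  then show ?case by (simp add: poly_op_0)
next
  case (pCons a p)
  have "kernel_op V K (poly_op V K p f) = (\<lambda>v. poly p \<mu> * kernel_op V K f v)"
    unfolding kernel_op_scale[symmetric] by (rule kernel_op_cong) (rule pCons.IH)
  then show ?case
    using assms(1)[OF pCons.prems] by (simp add: poly_op_pCons algebra_simps)
qed

text \<open>On \<open>n\<close> points the first \<open>n + 1\<close> iterates of \<open>f\<close>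
  under the operator are linearly dependent, and a dependence lists the coefficients of
  \<open>p\<close>.\<close>

lemma annihilating_poly:
  assumes "finite V"
  obtains p where "p \<noteq> 0" "\<And>v. v \<in> V \<Longrightarrow> poly_op V K p f v = 0"
proof -
  obtain vs where vs: "set vs = V" "distinct vs"
    using finite_distinct_list[OF assms] by blast
  define n where "n = length vs"
  \<comment> \<open>A zero row below the \<open>n\<close> point evaluations makes the matrix square,
    so that its vanishing determinant yields a kernel vector.\<close>
  define A where "A = mat (Suc n) (Suc n)
    (\<lambda>(i, k). if i < n then (kernel_op V K ^^ k) f (vs ! i) else 0)"
  have A: "A \<in> carrier_mat (Suc n) (Suc n)"
    by (simp add: A_def)
  have "A = mat\<^sub>r (Suc n) (Suc n) (\<lambda>i. if i = n then 0\<^sub>v (Suc n) else row A i)"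
    by (rule eq_matI) (auto simp: A_def)
  then have "det A = 0"
    using det_row_0[of n "Suc n" "row A"] A by auto
  then obtain c where c: "c \<in> carrier_vec (Suc n)" "c \<noteq> 0\<^sub>v (Suc n)" "A *\<^sub>v c = 0\<^sub>v (Suc n)"
    using det_0_iff_vec_prod_zero_field[OF A] by blast
  define p where "p = Poly (list_of_vec c)"
  have len: "length (list_of_vec c) = Suc n"
    using c(1) by simp
  have cf: "coeff p k = c $ k" if "k < Suc n" for k
    using that len c(1) by (simp add: p_def nth_default_def list_of_vec_index)
  have cf0: "coeff p k = 0" if "\<not> k < Suc n" for k
    using that len by (simp add: p_def nth_default_def)
  have deg: "degree p \<le> n"
    using cf0 by (intro degree_le) auto
  have "p \<noteq> 0"
  proof
    assume "p = 0"
    then have "c = 0\<^sub>v (Suc n)"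
      using c(1) cf by (intro eq_vecI) auto
    with c(2) show False by simp
  qed
  moreover have "poly_op V K p f v = 0" if "v \<in> V" for v
  proof -
    obtain i where i: "i < n" "vs ! i = v"
      using \<open>v \<in> V\<close> vs by (auto simp: in_set_conv_nth n_def)
    have "0 = (A *\<^sub>v c) $ i"
      using c(3) i by simp
    also have "\<dots> = (\<Sum>k<Suc n. (kernel_op V K ^^ k) f v * c $ k)"
      using i c(1) A by (simp add: scalar_prod_def A_def atLeast0LessThan)
    also have "\<dots> = poly_op V K p f v"
      unfolding poly_op_eq_sum[OF deg] lessThan_Suc_atMost
      by (intro sum.cong) (auto simp: cf)
    finally show ?thesis by simp
  qed
  ultimately show ?thesis using that by blast
qed

text \<open>
  The eigenfunction is \<open>q(T) w\<close>, where \<open>w = (T - c) \<delta>\<^sub>u\<close> and \<open>(X - \<mu>) q\<close> is the minimal polynomial of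
  \<open>w\<close>. Its squared norm is \<open>cnj (q \<mu>)\<close> times \<open>\<langle>x, w\<rangle> = (\<mu> - c) x u\<close>, so neither factor vanishes.
\<close>

lemma eigenfunction_in_support:
  assumes fin: "finite V" and sym: "\<And>v w. K v w = K w v" and u: "u \<in> V"
    and v0: "v0 \<in> V" "K v0 u \<noteq> (if v0 = u then c else 0)"
  obtains x \<mu> where "\<And>v. v \<in> V \<Longrightarrow> kernel_op V K x v = \<mu> * x v" "x u \<noteq> 0" "\<mu> \<noteq> of_real c"
proof -
  define w :: "'a \<Rightarrow> complex" where "w v = of_real (K v u - (if v = u then c else 0))" for v
  define P where "P p \<longleftrightarrow> p \<noteq> 0 \<and> (\<forall>v\<in>V. poly_op V K p w v = 0)" for p
  have "\<exists>p. P p"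
    using annihilating_poly[OF fin] unfolding P_def by metis
  then obtain p where p: "P p" and min: "\<And>q. P q \<Longrightarrow> degree p \<le> degree q"
    using ex_has_least_nat[of P _ degree] by blast
  have "w v0 \<noteq> 0"
    using v0(2) by (simp add: w_def)
  \<comment> \<open>This is where \<open>v0\<close> enters: \<open>w v0\<close> is nonzero, so no
    nonzero constant annihilates \<open>w\<close>.\<close>
  have "degree p \<noteq> 0"
  proof
    assume "degree p = 0"
    then obtain a where "p = [:a:]"
      by (rule degree_eq_zeroE)
    then show False
      using p v0(1) \<open>w v0 \<noteq> 0\<close> by (auto simp: P_def poly_op_def)
  qed
  then obtain \<mu> where "poly p \<mu> = 0"
    using fundamental_theorem_of_algebra[of p] by (auto simp: constant_degree)
  then obtain q where q: "p = [:-\<mu>, 1:] * q"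
    by (metis dvdE poly_eq_0_iff_dvd)
  have "q \<noteq> 0"
    using p q by (auto simp: P_def)
  then have "degree q < degree p"
    unfolding q by (subst degree_mult_eq) auto
  then have "\<not> P q"
    using min leD by blast
  define x where "x = poly_op V K q w"
  obtain v1 where v1: "v1 \<in> V" "x v1 \<noteq> 0"
    using \<open>\<not> P q\<close> \<open>q \<noteq> 0\<close> by (auto simp: P_def x_def)
  have eig: "kernel_op V K x v = \<mu> * x v" if "v \<in> V" for v
    using p that unfolding P_def q x_def poly_op_linear_factor by simp
  have "(\<Sum>v\<in>V. x v * cnj (x v)) \<noteq> 0"
  proof -
    have "(\<Sum>v\<in>V. x v * cnj (x v)) = of_real (\<Sum>v\<in>V. (cmod (x v))\<^sup>2)"
      by (simp add: complex_norm_square del: of_real_power)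
    moreover have "(\<Sum>v\<in>V. (cmod (x v))\<^sup>2) > 0"
      using fin v1 by (intro sum_pos2) auto
    ultimately show ?thesis by (metis less_irrefl of_real_eq_0_iff)
  qed
  moreover have "(\<Sum>v\<in>V. x v * cnj (x v)) = (\<Sum>v\<in>V. x v * poly_op V K (map_poly cnj q) w v)"
    unfolding x_def by (subst poly_op_cnj) (auto simp: w_def)
  moreover have "\<dots> = (\<Sum>v\<in>V. poly_op V K (map_poly cnj q) x v * w v)"
    by (rule poly_op_symmetric[OF sym, symmetric])
  moreover have "\<dots> = poly (map_poly cnj q) \<mu> * (\<Sum>v\<in>V. w v * x v)"
    unfolding sum_distrib_left
    by (intro sum.cong refl) (simp add: poly_op_eigen[OF eig])
  moreover have "(\<Sum>v\<in>V. w v * x v) = (\<mu> - of_real c) * x u"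
  proof -
    have "(\<Sum>v\<in>V. w v * x v)
        = (\<Sum>v\<in>V. of_real (K u v) * x v) - (\<Sum>v\<in>V. if v = u then of_real c * x u else 0)"
      unfolding sum_subtractf[symmetric]
      by (intro sum.cong refl) (auto simp: w_def sym[of u] algebra_simps)
    also have "\<dots> = kernel_op V K x u - of_real c * x u"
      using fin u by (simp add: kernel_op_def)
    finally show ?thesis
      using eig[OF u] by (simp add: algebra_simps)
  qed
  ultimately have "(\<mu> - of_real c) * x u \<noteq> 0"
    by auto
  then show ?thesis
    using eig by (intro that[of x \<mu>]) auto
qed

section \<open>Signless Laplacian eigenfunctions and state transfer\<close>

definition signless_laplacian_op :: "'a pair_pre_digraph \<Rightarrow> ('a \<Rightarrow> complex) \<Rightarrow> 'a \<Rightarrow> complex" where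
  "signless_laplacian_op G f v =
     of_nat (out_degree (with_proj G) v) * f v + (\<Sum>w | (v, w) \<in> parcs G. f w)"

definition eigenfunction :: "'a pair_pre_digraph \<Rightarrow> complex \<Rightarrow> ('a \<Rightarrow> complex) \<Rightarrow> bool" where
  "eigenfunction G \<theta> f \<longleftrightarrow> (\<forall>v\<in>pverts G. signless_laplacian_op G f v = \<theta> * f v)"

text \<open>State transfer paired with an eigenfunction \<open>f\<close>. Apart from
  \<open>t \<noteq> 0\<close>, the later arguments use only this form, which is free of
  matrices.\<close>

definition transfers :: "'a pair_pre_digraph \<Rightarrow> real \<Rightarrow> complex \<Rightarrow> 'a \<Rightarrow> 'a \<Rightarrow> bool" where
  "transfers G t z u v \<longleftrightarrow>
     (\<forall>\<theta> f. eigenfunction G \<theta> f \<longrightarrow> exp (- \<i> * complex_of_real t * \<theta>) * f u = z * f v)"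

definition vec_of_fun :: "'a pair_pre_digraph \<Rightarrow> ('a \<Rightarrow> complex) \<Rightarrow> complex vec" where
  "vec_of_fun G f = vec (card (pverts G)) (\<lambda>i. f (vertex_list G ! i))"

text \<open>From \<open>W A = \<theta> W\<close> follows \<open>W A^k = \<theta>^k W\<close>, and
  the finite sum over rows passes through the exponential series.\<close>

lemma mat_exp_left_eigenvector:
  fixes A :: "complex mat"
  assumes A: "A \<in> carrier_mat n n"
    and eig: "\<And>j. j < n \<Longrightarrow> (\<Sum>i<n. W i * A $$ (i, j)) = \<theta> * W j" and j: "j < n"
  shows "(\<Sum>i<n. W i * mat_exp A $$ (i, j)) = exp \<theta> * W j"
proof -
  have pow: "(\<Sum>i<n. W i * (A ^\<^sub>m k) $$ (i, j)) = \<theta> ^ k * W j" if "j < n" for j k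
    using that
  proof (induction k arbitrary: j)
    case 0
    have "(\<Sum>i<n. W i * (A ^\<^sub>m 0) $$ (i, j)) = (\<Sum>i<n. if i = j then W j else 0)"
      using A 0 by (intro sum.cong) auto
    then show ?case using 0 by simp
  next
    case (Suc k)
    have Ak: "A ^\<^sub>m k \<in> carrier_mat n n" using A by (rule pow_carrier_mat)
    have "(\<Sum>i<n. W i * (A ^\<^sub>m Suc k) $$ (i, j))
        = (\<Sum>i<n. \<Sum>c<n. W i * (A ^\<^sub>m k) $$ (i, c) * A $$ (c, j))"
      using A Ak Suc.prems
      by (auto simp: scalar_prod_def atLeast0LessThan sum_distrib_left mult.assoc intro!: sum.cong)
    also have "\<dots> = (\<Sum>c<n. \<Sum>i<n. W i * (A ^\<^sub>m k) $$ (i, c) * A $$ (c, j))"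
      by (rule sum.swap)
    also have "\<dots> = (\<Sum>c<n. \<theta> ^ k * (W c * A $$ (c, j)))"
      by (intro sum.cong refl) (simp add: Suc.IH flip: sum_distrib_right)
    also have "\<dots> = \<theta> ^ Suc k * W j"
      by (simp add: eig[OF Suc.prems] flip: sum_distrib_left)
    finally show ?case .
  qed
  have "(\<Sum>i<n. W i * mat_exp A $$ (i, j)) = (\<Sum>i<n. W i * (\<Sum>k. (A ^\<^sub>m k) $$ (i, j) / fact k))"
    using A j by (auto simp: mat_exp_def intro!: sum.cong)
  also have "\<dots> = (\<Sum>i<n. \<Sum>k. W i * ((A ^\<^sub>m k) $$ (i, j) / fact k))"
    using A j by (intro sum.cong refl suminf_mult[symmetric] summable_mat_exp) auto
  also have "\<dots> = (\<Sum>k. \<Sum>i<n. W i * ((A ^\<^sub>m k) $$ (i, j) / fact k))"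
    using A j by (intro suminf_sum[symmetric] summable_mult summable_mat_exp) auto
  also have "\<dots> = (\<Sum>k. \<theta> ^ k / fact k * W j)"
    using pow[OF j] by (intro suminf_cong) (simp flip: sum_divide_distrib)
  also have "\<dots> = (\<Sum>k. \<theta> ^ k / fact k) * W j"
    using summable_exp_generic[of \<theta>]
    by (intro suminf_mult2[symmetric]) (simp add: scaleR_conv_of_real divide_inverse mult.commute)
  also have "(\<Sum>k. \<theta> ^ k / fact k) = exp \<theta>"
    by (simp add: exp_def scaleR_conv_of_real divide_inverse mult.commute)
  finally show ?thesis .
qed

lemma mat_exp_0:
  assumes "i < n" "j < n"
  shows "mat_exp (0\<^sub>m n n) $$ (i, j) = of_bool (i = j)"
proof -
  have z: "(0\<^sub>m n n :: complex mat) ^\<^sub>m k = (if k = 0 then 1\<^sub>m n else 0\<^sub>m n n)" for k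
    by (cases k) auto
  have "(\<Sum>k. ((0\<^sub>m n n :: complex mat) ^\<^sub>m k) $$ (i, j) / fact k)
      = (\<Sum>k\<in>{0}. ((0\<^sub>m n n :: complex mat) ^\<^sub>m k) $$ (i, j) / fact k)"
    using assms by (intro suminf_finite) (auto simp: z)
  then show ?thesis
    using assms by (simp add: mat_exp_def)
qed

section \<open>From matrices over a vertex list to functions on vertices\<close>

context pair_graph
begin

lemma bij_vertex_list: "bij_betw ((!) (vertex_list G)) {..<card (pverts G)} (pverts G)"
  using vertex_list[OF pair_finite_verts] bij_betw_nth[of "vertex_list G"]
  by (metis distinct_card)

lemma vertex_list_nth: "i < card (pverts G) \<Longrightarrow> vertex_list G ! i \<in> pverts G"
  using bij_betwE[OF bij_vertex_list] by auto

lemma vertex_list_index: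
  assumes "u \<in> pverts G"
  obtains i where "i < card (pverts G)" "vertex_list G ! i = u"
  using bij_betw_imp_surj_on[OF bij_vertex_list] assms by (metis imageE lessThan_iff)

lemma vertex_list_inj:
  "i < card (pverts G) \<Longrightarrow> j < card (pverts G) \<Longrightarrow> vertex_list G ! i = vertex_list G ! j \<longleftrightarrow> i = j"
  using bij_betw_imp_inj_on[OF bij_vertex_list] by (auto simp: inj_on_def)

lemma sum_vertex_list:
  "(\<Sum>i<card (pverts G). f (vertex_list G ! i)) = (\<Sum>v\<in>pverts G. f v)"
  by (rule sum.reindex_bij_betw[OF bij_vertex_list])

lemma signless_laplacian_carrier:
  "signless_laplacian G \<in> carrier_mat (card (pverts G)) (card (pverts G))"
  by (simp add: signless_laplacian_def adjacency_mat_def degree_mat_def)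

lemma signless_laplacian_index:
  assumes "i < card (pverts G)" "j < card (pverts G)"
  shows "signless_laplacian G $$ (i, j) =
    (if i = j then of_nat (out_degree (with_proj G) (vertex_list G ! i)) else 0)
    + of_bool ((vertex_list G ! i, vertex_list G ! j) \<in> parcs G)"
  using assms by (simp add: signless_laplacian_def adjacency_mat_def degree_mat_def)

lemma parcs_sym: "(u, v) \<in> parcs G \<longleftrightarrow> (v, u) \<in> parcs G"
  using pair_sym_arcs unfolding symmetric_def by (auto elim: symE)

lemma signless_laplacian_sym:
  assumes "i < card (pverts G)" "j < card (pverts G)"
  shows "signless_laplacian G $$ (i, j) = signless_laplacian G $$ (j, i)"
  using assms parcs_sym by (auto simp: signless_laplacian_index)

lemma signless_laplacian_mult_vec:
  assumes "i < card (pverts G)"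
  shows "(\<Sum>j<card (pverts G). signless_laplacian G $$ (i, j) * f (vertex_list G ! j))
    = signless_laplacian_op G f (vertex_list G ! i)"
proof -
  let ?v = "vertex_list G ! i" and ?n = "card (pverts G)"
  have "(\<Sum>j<?n. signless_laplacian G $$ (i, j) * f (vertex_list G ! j))
     = (\<Sum>j<?n. if i = j then of_nat (out_degree (with_proj G) ?v) * f ?v else 0)
       + (\<Sum>j<?n. of_bool ((?v, vertex_list G ! j) \<in> parcs G) * f (vertex_list G ! j))"
    unfolding sum.distrib[symmetric] using assms
    by (intro sum.cong refl) (auto simp: signless_laplacian_index algebra_simps)
  also have "(\<Sum>j<?n. of_bool ((?v, vertex_list G ! j) \<in> parcs G) * f (vertex_list G ! j))
     = (\<Sum>w\<in>pverts G. of_bool ((?v, w) \<in> parcs G) * f w)"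
    by (rule sum_vertex_list)
  also have "\<dots> = (\<Sum>w | (?v, w) \<in> parcs G. f w)"
    using pair_finite_verts
    by (intro sum.mono_neutral_cong_right) (auto dest: in_arcsD2)
  finally show ?thesis
    using assms by (simp add: signless_laplacian_op_def)
qed

text \<open>The bridge by which the integrality hypothesis, stated for matrices, reaches
  eigenfunctions.\<close>

lemma eigenvalue_of_eigenfunction:
  fixes \<mu> :: complex
  assumes eig: "eigenfunction G \<mu> f" and u: "u \<in> pverts G" "f u \<noteq> 0"
  shows "eigenvalue (signless_laplacian G) \<mu>"
proof -
  let ?n = "card (pverts G)" and ?W = "vec_of_fun G f"
  have dim: "dim_row (signless_laplacian G) = ?n" "dim_col (signless_laplacian G) = ?n"
    using signless_laplacian_carrier by auto
  have "signless_laplacian G *\<^sub>v ?W = \<mu> \<cdot>\<^sub>v ?W"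
  proof (rule eq_vecI)
    fix i assume "i < dim_vec (\<mu> \<cdot>\<^sub>v ?W)"
    then have i: "i < ?n"
      by (simp add: vec_of_fun_def)
    have "(signless_laplacian G *\<^sub>v ?W) $ i
        = (\<Sum>j<?n. signless_laplacian G $$ (i, j) * f (vertex_list G ! j))"
      using i dim by (simp add: scalar_prod_def vec_of_fun_def atLeast0LessThan)
    then show "(signless_laplacian G *\<^sub>v ?W) $ i = (\<mu> \<cdot>\<^sub>v ?W) $ i"
      using i signless_laplacian_mult_vec[OF i] eig vertex_list_nth[OF i]
      by (simp add: eigenfunction_def vec_of_fun_def)
  qed (simp add: dim vec_of_fun_def)
  moreover have "?W \<noteq> 0\<^sub>v ?n"
  proof -
    obtain i where "i < ?n" "vertex_list G ! i = u"
      using vertex_list_index[OF u(1)] .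
    with u(2) have "i < ?n" "?W $ i \<noteq> 0\<^sub>v ?n $ i"
      by (simp_all add: vec_of_fun_def)
    then show ?thesis by metis
  qed
  ultimately show ?thesis
    unfolding eigenvalue_def eigenvector_def dim by (intro exI[of _ ?W]) (auto simp: vec_of_fun_def)
qed

lemma transfersI:
  assumes eq: "mat_exp ((- \<i> * complex_of_real t) \<cdot>\<^sub>m signless_laplacian G) *\<^sub>v char_vec G u
      = z \<cdot>\<^sub>v char_vec G v"
    and u: "u \<in> pverts G" and v: "v \<in> pverts G"
  shows "transfers G t z u v"
  unfolding transfers_def
proof (intro allI impI)
  fix \<theta> f assume eig: "eigenfunction G \<theta> f"
  let ?n = "card (pverts G)" and ?c = "- \<i> * complex_of_real t" and ?vs = "vertex_list G"
  let ?H = "signless_laplacian G"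
  let ?E = "mat_exp (?c \<cdot>\<^sub>m ?H)"
  obtain a where a: "a < ?n" "?vs ! a = u" using vertex_list_index[OF u] .
  obtain b where b: "b < ?n" "?vs ! b = v" using vertex_list_index[OF v] .
  have A: "?c \<cdot>\<^sub>m ?H \<in> carrier_mat ?n ?n"
    using signless_laplacian_carrier by simp
  have dim: "dim_row ?E = ?n" "dim_col ?E = ?n"
    using signless_laplacian_carrier by (simp_all add: mat_exp_def)
  \<comment> \<open>By symmetry of the signless Laplacian an eigenfunction is also a left
    eigenvector.\<close>
  have left: "(\<Sum>i<?n. f (?vs ! i) * (?c \<cdot>\<^sub>m ?H) $$ (i, j)) = ?c * \<theta> * f (?vs ! j)"
    if j: "j < ?n" for j
  proof -
    have "(\<Sum>i<?n. f (?vs ! i) * (?c \<cdot>\<^sub>m ?H) $$ (i, j))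
        = (\<Sum>i<?n. ?c * (?H $$ (j, i) * f (?vs ! i)))"
      using j signless_laplacian_carrier signless_laplacian_sym[of _ j]
      by (intro sum.cong refl) auto
    also have "\<dots> = ?c * (\<theta> * f (?vs ! j))"
      unfolding sum_distrib_left[symmetric] signless_laplacian_mult_vec[OF j]
      using eig vertex_list_nth[OF j] by (simp add: eigenfunction_def)
    finally show ?thesis by simp
  qed
  have col: "(?E *\<^sub>v char_vec G u) $ i = ?E $$ (i, a)" if "i < ?n" for i
  proof -
    have "(?E *\<^sub>v char_vec G u) $ i = (\<Sum>j<?n. ?E $$ (i, j) * of_bool (?vs ! j = u))"
      using that dim by (simp add: char_vec_def scalar_prod_def atLeast0LessThan)
    also have "\<dots> = (\<Sum>j<?n. if j = a then ?E $$ (i, a) else 0)"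
      using a vertex_list_inj by (intro sum.cong) auto
    finally show ?thesis using a by simp
  qed
  have "exp (?c * \<theta>) * f u = (\<Sum>i<?n. f (?vs ! i) * ?E $$ (i, a))"
    using mat_exp_left_eigenvector[OF A left a(1)] a by simp
  also have "\<dots> = (\<Sum>i<?n. f (?vs ! i) * (z \<cdot>\<^sub>v char_vec G v) $ i)"
    by (intro sum.cong refl) (simp only: eq[symmetric] col lessThan_iff)
  also have "\<dots> = (\<Sum>i<?n. if i = b then z * f v else 0)"
    using b vertex_list_inj by (intro sum.cong) (auto simp: char_vec_def)
  finally show "exp (?c * \<theta>) * f u = z * f v" using b by simp
qed

text \<open>At time 0 the exponential is the identity, so entry \<open>u\<close> would be 1 on the
  left and 0 on the right.\<close>

lemma PST_time_nonzero:
  assumes eq: "mat_exp ((- \<i> * complex_of_real t) \<cdot>\<^sub>m signless_laplacian G) *\<^sub>v char_vec G u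
      = z \<cdot>\<^sub>v char_vec G v"
    and u: "u \<in> pverts G" and uv: "u \<noteq> v"
  shows "t \<noteq> 0"
proof
  let ?n = "card (pverts G)" and ?vs = "vertex_list G"
  assume "t = 0"
  moreover have "0 \<cdot>\<^sub>m signless_laplacian G = 0\<^sub>m ?n ?n"
    using signless_laplacian_carrier by (intro eq_matI) auto
  ultimately have *: "mat_exp (0\<^sub>m ?n ?n) *\<^sub>v char_vec G u = z \<cdot>\<^sub>v char_vec G v"
    using eq by simp
  obtain a where a: "a < ?n" "?vs ! a = u" using vertex_list_index[OF u] .
  have "(mat_exp (0\<^sub>m ?n ?n) *\<^sub>v char_vec G u) $ a
      = (\<Sum>j<?n. mat_exp (0\<^sub>m ?n ?n) $$ (a, j) * of_bool (?vs ! j = u))"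
    using a by (simp add: char_vec_def scalar_prod_def atLeast0LessThan mat_exp_def)
  also have "\<dots> = (\<Sum>j<?n. if j = a then 1 else 0)"
    using a vertex_list_inj by (intro sum.cong) (auto simp: mat_exp_0)
  finally have "(mat_exp (0\<^sub>m ?n ?n) *\<^sub>v char_vec G u) $ a = 1"
    using a by simp
  moreover have "(z \<cdot>\<^sub>v char_vec G v) $ a = 0"
    using a uv by (simp add: char_vec_def)
  ultimately show False
    using * by simp
qed

end

section \<open>Incidence sums\<close>

text \<open>One definition for an incidence matrix and its transpose: exchanging the two index sets
  and flipping \<open>I\<close> passes from one to the other.\<close>

definition inc_sum :: "'a set \<Rightarrow> ('a \<Rightarrow> 'b \<Rightarrow> bool) \<Rightarrow> ('a \<Rightarrow> complex) \<Rightarrow> 'b \<Rightarrow> complex" where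
  "inc_sum A I x b = (\<Sum>a | a \<in> A \<and> I a b. x a)"

lemma inc_sum_cong: "(\<And>a. a \<in> A \<Longrightarrow> x a = y a) \<Longrightarrow> inc_sum A I x = inc_sum A I y"
  by (auto simp: inc_sum_def intro!: sum.cong)

lemma inc_sum_scale: "inc_sum A I (\<lambda>a. c * x a) b = c * inc_sum A I x b"
  by (simp add: inc_sum_def sum_distrib_left)

lemma inc_sum_cnj: "inc_sum A I (\<lambda>a. cnj (x a)) b = cnj (inc_sum A I x b)"
  by (simp add: inc_sum_def)

lemma inc_sum_0: "inc_sum A I (\<lambda>a. 0) b = 0"
  by (simp add: inc_sum_def)

lemma inc_sum_adjoint:
  assumes "finite A" "finite B"
  shows "(\<Sum>a\<in>A. inc_sum B (\<lambda>b a. I a b) y a * g a) = (\<Sum>b\<in>B. y b * inc_sum A I g b)"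
proof -
  have "(\<Sum>a\<in>A. inc_sum B (\<lambda>b a. I a b) y a * g a) = (\<Sum>a\<in>A. \<Sum>b | b \<in> B \<and> I a b. y b * g a)"
    by (simp add: inc_sum_def sum_distrib_right)
  also have "\<dots> = (\<Sum>b\<in>B. \<Sum>a | a \<in> A \<and> I a b. y b * g a)"
    by (rule sum.swap_restrict[OF assms])
  finally show ?thesis
    by (simp add: inc_sum_def sum_distrib_left)
qed

text \<open>If \<open>M M^T x = 0\<close>, then the squared norm of \<open>M^T x\<close> is the
  pairing of \<open>M M^T x\<close> with \<open>cnj x\<close>, hence 0.\<close>

lemma inc_sum_gram_kernel:
  assumes "finite A" "finite B"
    and "\<And>a. a \<in> A \<Longrightarrow> inc_sum B (\<lambda>b a. I a b) (inc_sum A I x) a = 0" and "b \<in> B"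
  shows "inc_sum A I x b = 0"
proof -
  have "of_real (\<Sum>b\<in>B. (cmod (inc_sum A I x b))\<^sup>2)
      = (\<Sum>b\<in>B. inc_sum A I x b * inc_sum A I (\<lambda>a. cnj (x a)) b)"
    by (simp add: complex_norm_square inc_sum_cnj del: of_real_power)
  also have "\<dots> = (\<Sum>a\<in>A. inc_sum B (\<lambda>b a. I a b) (inc_sum A I x) a * cnj (x a))"
    by (rule inc_sum_adjoint[OF assms(1,2), symmetric])
  also have "\<dots> = of_real 0"
    using assms(3) by simp
  finally have "(\<Sum>b\<in>B. (cmod (inc_sum A I x b))\<^sup>2) = 0"
    unfolding of_real_eq_iff .
  then show ?thesis
    using assms(2,4) by (simp add: sum_nonneg_eq_0_iff)
qed

text \<open>The entries of \<open>M M^T\<close> count common incidences; written as a symmetric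
  kernel, this matrix is open to \<open>eigenfunction_in_support\<close>.\<close>

lemma kernel_op_gram:
  assumes "finite A" "finite B"
  shows "kernel_op A (\<lambda>a a'. real (card {b \<in> B. I a b \<and> I a' b})) x a
    = inc_sum B (\<lambda>b a. I a b) (inc_sum A I x) a"
proof -
  have "inc_sum B (\<lambda>b a. I a b) (inc_sum A I x) a
      = (\<Sum>b\<in>{b\<in>B. I a b}. \<Sum>a' | a' \<in> A \<and> I a' b. x a')"
    by (simp add: inc_sum_def)
  also have "\<dots> = (\<Sum>a'\<in>A. \<Sum>b | b \<in> {b\<in>B. I a b} \<and> I a' b. x a')"
    using assms by (intro sum.swap_restrict) auto
  also have "\<dots> = kernel_op A (\<lambda>a a'. real (card {b \<in> B. I a b \<and> I a' b})) x a"
    by (simp add: kernel_op_def conj_assoc)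
  finally show ?thesis by simp
qed

text \<open>The diagonal entry of the Gram matrix at \<open>u\<close> differs from \<open>c\<close>,
  so the indicator of \<open>u\<close> is not an eigenfunction for \<open>c\<close>;
  \<open>u\<close> itself serves as \<open>v0\<close>.\<close>

lemma gram_eigenfunction_in_support:
  assumes fin: "finite A" "finite B" and u: "u \<in> A" and c: "card {b \<in> B. I u b} \<noteq> c"
  obtains x \<mu> where
    "\<And>a. a \<in> A \<Longrightarrow> inc_sum B (\<lambda>b a. I a b) (inc_sum A I x) a = \<mu> * x a"
    "x u \<noteq> 0" "\<mu> \<noteq> of_nat c" "\<And>b. \<mu> = 0 \<Longrightarrow> b \<in> B \<Longrightarrow> inc_sum A I x b = 0"
proof -
  let ?K = "\<lambda>a a'. real (card {b \<in> B. I a b \<and> I a' b})"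
  have ne: "?K u u \<noteq> (if u = u then real c else 0)"
    using c by simp
  have sym: "?K v w = ?K w v" for v w
    by (simp add: conj_commute)
  obtain x \<mu> where x: "\<And>v. v \<in> A \<Longrightarrow> kernel_op A ?K x v = \<mu> * x v" "x u \<noteq> 0"
      "\<mu> \<noteq> of_real (real c)"
    using eigenfunction_in_support[of A ?K u u "real c", OF fin(1) sym u u ne] by blast
  note eig = x(1)[unfolded kernel_op_gram[OF fin]]
  show ?thesis
    using eig x(2,3) by (intro that[of x \<mu>] inc_sum_gram_kernel[OF fin]) auto
qed

section \<open>Signless Laplacian and line graph in terms of the incidence matrix\<close>

context pair_graph
begin

text \<open>With \<open>R\<close> the vertex-edge incidence matrix, \<open>vertex_sum\<close> is
  \<open>R^T\<close> and \<open>edge_sum\<close> is \<open>R\<close>.\<close>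

abbreviation vertex_sum :: "('a \<Rightarrow> complex) \<Rightarrow> 'a set \<Rightarrow> complex" where
  "vertex_sum \<equiv> inc_sum (pverts G) (\<lambda>u e. u \<in> e)"

abbreviation edge_sum :: "('a set \<Rightarrow> complex) \<Rightarrow> 'a \<Rightarrow> complex" where
  "edge_sum \<equiv> inc_sum (edges G) (\<lambda>e u. u \<in> e)"

lemma edgesE:
  assumes "e \<in> edges G"
  obtains a b where "e = {a, b}" "a \<noteq> b" "a \<in> pverts G" "b \<in> pverts G" "(a, b) \<in> parcs G"
proof -
  obtain a b where "e = {a, b}" and ab: "(a, b) \<in> parcs G"
    using assms by (auto simp: edges_def)
  then show ?thesis
    using pair_no_loops[OF ab] in_arcsD1[OF ab] in_arcsD2[OF ab] by (intro that[of a b]) auto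
qed

lemma finite_edges: "finite (edges G)"
proof (rule finite_subset)
  show "edges G \<subseteq> Pow (pverts G)" by (auto elim: edgesE)
qed (simp add: pair_finite_verts)

lemma vertex_sum_edge:
  assumes "{a, b} \<in> edges G" "a \<noteq> b"
  shows "vertex_sum x {a, b} = x a + x b"
proof -
  have "{u. u \<in> pverts G \<and> u \<in> {a, b}} = {a, b}"
    using assms by (auto elim!: edgesE simp: doubleton_eq_iff)
  then show ?thesis using assms by (simp add: inc_sum_def)
qed

lemma edges_at: "{e. e \<in> edges G \<and> u \<in> e} = (\<lambda>w. {u, w}) ` {w. (u, w) \<in> parcs G}"
proof -
  have "e \<in> (\<lambda>w. {u, w}) ` {w. (u, w) \<in> parcs G}" if "e \<in> edges G" "u \<in> e" for e
    using that parcs_sym by (auto simp: edges_def insert_commute)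
  then show ?thesis by (auto simp: edges_def)
qed

lemma inj_edge_at: "inj_on (\<lambda>w. {u, w}) X"
  by (auto simp: inj_on_def doubleton_eq_iff)

lemma out_degree_eq_card: "out_degree (with_proj G) u = card {w. (u, w) \<in> parcs G}"
proof -
  have "out_arcs (with_proj G) u = Pair u ` {w. (u, w) \<in> parcs G}"
    by (auto simp: out_arcs_def)
  then show ?thesis
    by (simp add: out_degree_def card_image inj_on_def)
qed

lemma out_degree_eq_card_edges: "out_degree (with_proj G) u = card {e \<in> edges G. u \<in> e}"
  unfolding out_degree_eq_card edges_at by (simp add: card_image inj_edge_at)

text \<open>The identity \<open>D + A = R R^T\<close>: every edge at \<open>u\<close> contributes
  \<open>x u\<close> and the value at its other endpoint.\<close>

lemma signless_laplacian_op_incidence: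
  "signless_laplacian_op G x u = edge_sum (vertex_sum x) u"
proof -
  have "edge_sum (vertex_sum x) u = (\<Sum>w | (u, w) \<in> parcs G. vertex_sum x {u, w})"
    unfolding inc_sum_def[of "edges G"] edges_at
    by (subst sum.reindex[OF inj_edge_at]) (simp add: o_def)
  also have "\<dots> = (\<Sum>w | (u, w) \<in> parcs G. x u + x w)"
    using pair_no_loops[of "(u, u)"] by (intro sum.cong refl vertex_sum_edge) (auto simp: edges_def)
  finally show ?thesis
    by (simp add: signless_laplacian_op_def out_degree_eq_card sum.distrib)
qed

text \<open>The line graph has adjacency matrix \<open>R^T R - 2 I\<close>: the edges at the two
  ends of \<open>e\<close> have only \<open>e\<close> in common, which is thus counted
  twice.\<close>

lemma edge_neighbours_sum:
  assumes "e \<in> edges G"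
  shows "(\<Sum>f | f \<in> edges G \<and> f \<noteq> e \<and> e \<inter> f \<noteq> {}. y f) = vertex_sum (edge_sum y) e - 2 * y e"
proof -
  obtain a b where e: "e = {a, b}" "a \<noteq> b"
    using edgesE[OF assms] by metis
  let ?N = "{f \<in> edges G. f \<noteq> e \<and> e \<inter> f \<noteq> {}}"
  let ?A = "{f. f \<in> edges G \<and> a \<in> f}" and ?B = "{f. f \<in> edges G \<and> b \<in> f}"
  have un: "?A \<union> ?B = insert e ?N"
    using assms e by auto
  have "f = e" if "f \<in> edges G" "a \<in> f" "b \<in> f" for f
    using that e by (auto elim!: edgesE)
  then have int: "?A \<inter> ?B = {e}"
    using assms e by blast
  have "sum y (?A \<union> ?B) + sum y (?A \<inter> ?B) = sum y ?A + sum y ?B"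
    using finite_edges by (intro sum.union_inter) auto
  moreover have "sum y (insert e ?N) = y e + sum y ?N"
    using finite_edges by (subst sum.insert) auto
  moreover have "vertex_sum (edge_sum y) e = sum y ?A + sum y ?B"
    using assms e by (simp add: vertex_sum_edge) (simp add: inc_sum_def)
  ultimately show ?thesis
    unfolding un int by (simp add: algebra_simps)
qed

end

section \<open>The Q-graph of a regular graph\<close>

locale regular_pair_graph = pair_graph +
  fixes r :: nat
  assumes reg: "regular r G"
begin

sublocale Q: pair_graph "Q_graph G"
  by (rule pair_graph_Q_graph) unfold_locales

lemma card_edges_at: "u \<in> pverts G \<Longrightarrow> card {e \<in> edges G. u \<in> e} = r"
  using reg by (simp add: regular_def flip: out_degree_eq_card_edges)

lemma vertex_sum_1:
  assumes "e \<in> edges G"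
  shows "vertex_sum (\<lambda>u. 1) e = 2"
proof -
  obtain a b where "e = {a, b}" "a \<noteq> b"
    using edgesE[OF assms] by metis
  then show ?thesis
    using assms by (simp add: vertex_sum_edge)
qed

lemma edge_sum_const: "u \<in> pverts G \<Longrightarrow> edge_sum (\<lambda>e. c) u = of_nat r * c"
  by (simp add: inc_sum_def card_edges_at)

lemma Q_verts: "pverts (Q_graph G) = pverts G <+> edges G"
  by (simp add: Q_graph_def)

lemma Q_op_old:
  assumes "u \<in> pverts G"
  shows "signless_laplacian_op (Q_graph G) (case_sum x y) (Inl u) = of_nat r * x u + edge_sum y u"
proof -
  have nb: "{w. (Inl u, w) \<in> parcs (Q_graph G)} = Inr ` {e \<in> edges G. u \<in> e}"
    by (auto simp: Q_graph_def)
  show ?thesis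
    unfolding signless_laplacian_op_def Q.out_degree_eq_card nb
    by (simp add: card_image card_edges_at[OF assms] sum.reindex inc_sum_def)
qed

text \<open>A new vertex has degree \<open>2r\<close>, from two endpoints and \<open>2r - 2\<close>
  adjacent edges. The coefficient of \<open>y e\<close> is this degree less the 2 in
  \<open>R^T R - 2 I\<close>.\<close>

lemma Q_op_new:
  assumes e: "e \<in> edges G"
  shows "signless_laplacian_op (Q_graph G) (case_sum x y) (Inr e) =
    (2 * of_nat r - 2) * y e + vertex_sum x e + vertex_sum (edge_sum y) e"
proof -
  let ?N = "{f \<in> edges G. f \<noteq> e \<and> e \<inter> f \<noteq> {}}"
  obtain a b where ab: "e = {a, b}" "a \<noteq> b" "a \<in> pverts G" "b \<in> pverts G"
    using edgesE[OF e] by metis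
  have nb: "{w. (Inr e, w) \<in> parcs (Q_graph G)} = Inl ` e \<union> Inr ` ?N"
    using e by (auto simp: Q_graph_def)
  have fin: "finite (Inl ` e :: ('a + 'a set) set)" "finite (Inr ` ?N :: ('a + 'a set) set)"
    using ab finite_edges by auto
  \<comment> \<open>Adjacent edges are counted by summing the constant function 1 over them.\<close>
  have "card ?N = vertex_sum (edge_sum (\<lambda>f. 1)) e - 2"
    using edge_neighbours_sum[OF e, of "\<lambda>f. 1"] by simp
  also have "vertex_sum (edge_sum (\<lambda>f. 1)) e = 2 * of_nat r"
    using ab e by (simp add: vertex_sum_edge edge_sum_const)
  finally have N: "of_nat (card ?N) = 2 * of_nat r - (2 :: complex)" .
  have "card (Inl ` e \<union> Inr ` ?N) =
      card (Inl ` e :: ('a + 'a set) set) + card (Inr ` ?N :: ('a + 'a set) set)"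
    by (rule card_Un_disjoint[OF fin]) auto
  also have "\<dots> = 2 + card ?N"
    using ab by (simp add: card_image)
  finally have "of_nat (card (Inl ` e \<union> Inr ` ?N)) = 2 * (of_nat r :: complex)"
    by (simp add: N)
  moreover have "sum (case_sum x y) (Inl ` e \<union> Inr ` ?N) = sum x e + sum y ?N"
    using fin by (subst sum.union_disjoint) (auto simp: sum.reindex)
  moreover have "sum x e = vertex_sum x e"
    using ab e by (simp add: vertex_sum_edge)
  ultimately show ?thesis
    unfolding signless_laplacian_op_def Q.out_degree_eq_card nb
    using edge_neighbours_sum[OF e, of y] by (simp add: algebra_simps)
qed

text \<open>Here \<open>H\<close> has the block rows \<open>(r I, R)\<close> and
  \<open>(R^T, (2r - 2) I + R^T R)\<close>.\<close>

lemma Q_eigenI: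
  assumes "\<And>u. u \<in> pverts G \<Longrightarrow> of_nat r * x u + edge_sum y u = \<theta> * x u"
    and "\<And>e. e \<in> edges G \<Longrightarrow>
      (2 * of_nat r - 2) * y e + vertex_sum x e + vertex_sum (edge_sum y) e = \<theta> * y e"
  shows "eigenfunction (Q_graph G) \<theta> (case_sum x y)"
  using assms by (auto simp: eigenfunction_def Q_verts Q_op_old Q_op_new)

text \<open>For \<open>y = b R^T x\<close> the first block gives the eigenvalue
  \<open>r + b \<mu>\<close>, and the second becomes the quadratic in \<open>b\<close> times
  \<open>R^T x\<close>.\<close>

lemma Q_eigen_lift:
  fixes \<mu> b :: complex
  assumes x: "\<And>u. u \<in> pverts G \<Longrightarrow> edge_sum (vertex_sum x) u = \<mu> * x u"
    and b: "\<mu> * b\<^sup>2 + (2 - of_nat r - \<mu>) * b - 1 = 0"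
  shows "eigenfunction (Q_graph G) (of_nat r + b * \<mu>) (case_sum x (\<lambda>e. b * vertex_sum x e))"
proof (rule Q_eigenI)
  have *: "edge_sum (\<lambda>e. b * vertex_sum x e) u = b * \<mu> * x u" if "u \<in> pverts G" for u
    using x[OF that] by (simp add: inc_sum_scale)
  then show "of_nat r * x u + edge_sum (\<lambda>e. b * vertex_sum x e) u = (of_nat r + b * \<mu>) * x u"
    if "u \<in> pverts G" for u
    using that by (simp add: algebra_simps)
  have "vertex_sum (edge_sum (\<lambda>e. b * vertex_sum x e)) = vertex_sum (\<lambda>u. b * \<mu> * x u)"
    by (rule inc_sum_cong) (rule *)
  then have "vertex_sum (edge_sum (\<lambda>e. b * vertex_sum x e)) e = b * \<mu> * vertex_sum x e" for e
    by (simp only: inc_sum_scale)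
  moreover have "(2 * of_nat r - 2) * (b * X) + X + b * \<mu> * X = (of_nat r + b * \<mu>) * (b * X)" for X
    using arg_cong[OF b, of "\<lambda>y. y * X"] by (simp add: algebra_simps power2_eq_square)
  ultimately show "(2 * of_nat r - 2) * (b * vertex_sum x e) + vertex_sum x e
      + vertex_sum (edge_sum (\<lambda>e. b * vertex_sum x e)) e
      = (of_nat r + b * \<mu>) * (b * vertex_sum x e)" for e
    by simp
qed

text \<open>This serves \<open>\<mu> = 0\<close> for \<open>R R^T\<close>, where
  \<open>R^T x = 0\<close> and extension by zero solves both blocks.\<close>

lemma Q_eigen_old:
  assumes "\<And>e. e \<in> edges G \<Longrightarrow> vertex_sum x e = 0"
  shows "eigenfunction (Q_graph G) (of_nat r) (case_sum x (\<lambda>e. 0))"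
  by (rule Q_eigenI) (simp_all add: assms(1) inc_sum_0[abs_def])

text \<open>The counterpart for the kernel of \<open>R^T R\<close>, where
  \<open>R y = 0\<close>.\<close>

lemma Q_eigen_new:
  assumes "\<And>u. u \<in> pverts G \<Longrightarrow> edge_sum y u = 0"
  shows "eigenfunction (Q_graph G) (2 * of_nat r - 2) (case_sum (\<lambda>u. 0) y)"
proof -
  have "vertex_sum (edge_sum y) = vertex_sum (\<lambda>u. 0)"
    by (rule inc_sum_cong) (rule assms(1))
  then show ?thesis
    by (intro Q_eigenI) (simp_all add: assms(1) inc_sum_0)
qed

end

section \<open>Eigenvalue differences and irrationality\<close>

lemma exp_eq_1E:
  fixes w :: complex
  assumes "exp w = 1"
  obtains n :: int where "w = of_real (of_int n * 2 * pi) * \<i>"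
proof -
  have re: "Re w = 0"
    using arg_cong[OF assms, of cmod] by simp
  then have "cos (Im w) = 1"
    using arg_cong[OF assms, of Re] by (simp add: exp_eq_polar)
  then obtain n :: int where "Im w = of_int n * 2 * pi"
    by (auto simp: cos_one_2pi_int)
  with re show ?thesis
    by (intro that[of n]) (simp add: complex_eq_iff)
qed

context pair_graph
begin

lemma signless_laplacian_op_cnj:
  "signless_laplacian_op G (\<lambda>w. cnj (f w)) v = cnj (signless_laplacian_op G f v)"
  by (simp add: signless_laplacian_op_def)

lemma eigenfunction_cnj:
  assumes "eigenfunction G \<theta> f"
  shows "eigenfunction G (cnj \<theta>) (\<lambda>w. cnj (f w))"
  using assms by (simp add: eigenfunction_def signless_laplacian_op_cnj)

text \<open>
  Comparing the transfer identity for \<open>f\<close> with the conjugate of the one for \<open>cnj f\<close>, whose eigenvalue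
  is \<open>cnj \<theta>\<close>, eliminates \<open>f v\<close>.
\<close>

lemma transfer_phase:
  assumes transfer: "transfers G t z u v"
    and z: "cmod z = 1"
    and eig: "eigenfunction G \<theta> f" and "f u \<noteq> 0"
  shows "exp (- 2 * \<i> * complex_of_real t * \<theta>) = z\<^sup>2"
proof -
  let ?E = "exp (- \<i> * complex_of_real t * \<theta>)" and ?E' = "exp (\<i> * complex_of_real t * \<theta>)"
  have 1: "?E * f u = z * f v"
    using transfer eig by (simp add: transfers_def)
  have "exp (- \<i> * complex_of_real t * cnj \<theta>) * cnj (f u) = z * cnj (f v)"
    by (rule transfer[unfolded transfers_def, rule_format, OF eigenfunction_cnj[OF eig]])
  then have "cnj (exp (- \<i> * complex_of_real t * cnj \<theta>) * cnj (f u)) = cnj (z * cnj (f v))"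
    by simp
  then have 2: "?E' * f u = cnj z * f v"
    by (simp add: exp_eq_polar cis_cnj)
  have zz: "z * cnj z = 1"
    using z by (simp add: complex_norm_square[symmetric])
  have "?E * f u = z\<^sup>2 * (cnj z * f v)"
    using 1 zz by (simp add: power2_eq_square mult.assoc[symmetric])
  also have "\<dots> = z\<^sup>2 * ?E' * f u"
    using 2 by simp
  finally have "?E = z\<^sup>2 * ?E'"
    using \<open>f u \<noteq> 0\<close> by simp
  then have "?E * ?E = z\<^sup>2 * (?E' * ?E)"
    by simp
  also have "?E' * ?E = 1"
    by (simp add: exp_add[symmetric])
  also have "?E * ?E = exp (- 2 * \<i> * complex_of_real t * \<theta>)"
    by (simp add: exp_add[symmetric] ac_simps)
  finally show ?thesis
    by simp
qed

text \<open>The phase \<open>z\<^sup>2\<close> in \<open>transfer_phase\<close> is the same for both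
  eigenvalues. The factor 2 there cancels that of the period of \<open>exp\<close>, leaving
  multiples of \<open>pi\<close>.\<close>

lemma transfer_eigenvalue_difference:
  assumes transfer: "transfers G t z u v"
    and z: "cmod z = 1"
    and f: "eigenfunction G \<theta> f" "f u \<noteq> 0"
    and g: "eigenfunction G \<tau> g" "g u \<noteq> 0"
  obtains k :: int where "complex_of_real t * (\<theta> - \<tau>) = of_int k * of_real pi"
proof -
  have "exp (- 2 * \<i> * complex_of_real t * \<theta>) = exp (- 2 * \<i> * complex_of_real t * \<tau>)"
    using transfer_phase[OF transfer z f] transfer_phase[OF transfer z g] by simp
  then have "exp (- 2 * \<i> * complex_of_real t * (\<theta> - \<tau>)) = 1"
    by (simp only: right_diff_distrib exp_diff) simp
  then obtain n :: int where
    "- 2 * \<i> * complex_of_real t * (\<theta> - \<tau>) = of_real (of_int n * 2 * pi) * \<i>"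
    by (rule exp_eq_1E)
  then have "(-2 * \<i>) * (complex_of_real t * (\<theta> - \<tau>)) = (-2 * \<i>) * (of_int (-n) * of_real pi)"
    by (simp add: algebra_simps)
  then have "complex_of_real t * (\<theta> - \<tau>) = of_int (-n) * of_real pi"
    by (subst (asm) mult_cancel_left) simp
  then show ?thesis by (rule that)
qed

end

text \<open>Since \<open>k\<close> divides \<open>N\<close>, the discriminant itself would be a
  square, but for \<open>r \<ge> 2\<close> it lies strictly between \<open>(3r - 1)^2\<close> and
  \<open>(3r)^2\<close>.\<close>

lemma discriminant_not_square:
  fixes r k N :: int
  assumes r: "r \<ge> 2" and k: "k \<noteq> 0" and eq: "(9 * r\<^sup>2 - 4 * r + 4) * k\<^sup>2 = N\<^sup>2"
  shows False
proof -
  have "k\<^sup>2 dvd N\<^sup>2"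
    using eq by (metis dvd_triv_right)
  then have "k dvd N"
    by (simp add: pow_divides_pow_iff)
  then obtain c where "N = k * c" ..
  then have D: "9 * r\<^sup>2 - 4 * r + 4 = \<bar>c\<bar>\<^sup>2"
    using eq k by (simp add: power_mult_distrib)
  have "(3 * r - 1)\<^sup>2 < \<bar>c\<bar>\<^sup>2" "\<bar>c\<bar>\<^sup>2 < (3 * r)\<^sup>2"
    unfolding D[symmetric] using r by (simp_all add: power2_eq_square algebra_simps)
  then have "3 * r - 1 < \<bar>c\<bar>" "\<bar>c\<bar> < 3 * r"
    using r by (auto intro: power_less_imp_less_base[where n = 2])
  then show False by linarith
qed

text \<open>Eliminating \<open>t\<close> and \<open>pi\<close> from the two relations gives
  \<open>k sqrt D = k' N\<close>. If \<open>N\<close> were nonzero, so would be \<open>k\<close>,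
  and \<open>sqrt D\<close> would be rational.\<close>

lemma commensurable_with_discriminant_eq_0:
  fixes t :: real and r N k k' :: int
  assumes r: "r \<ge> 2" and t: "t \<noteq> 0"
    and k: "complex_of_real t * of_int N = of_int k * of_real pi"
    and k': "t * sqrt (of_int (9 * r\<^sup>2 - 4 * r + 4)) = of_int k' * pi"
  shows "N = 0"
proof (rule ccontr)
  assume "N \<noteq> 0"
  let ?D = "9 * r\<^sup>2 - 4 * r + 4"
  have "of_real (t * of_int N) = complex_of_real (of_int k * pi)"
    using k by simp
  then have k_real: "t * of_int N = of_int k * pi"
    unfolding of_real_eq_iff .
  have "r * 1 \<le> r * r"
    using r by (intro mult_left_mono) auto
  then have D: "?D > 0"
    unfolding power2_eq_square using r by linarith
  have "t * (of_int k * sqrt (of_int ?D)) = of_int k * (of_int k' * pi)"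
    using k' by simp
  also have "\<dots> = t * (of_int k' * of_int N)"
    using k_real by simp
  finally have "of_int k * sqrt (of_int ?D) = of_int k' * (of_int N :: real)"
    using t by simp
  then have "(of_int k * sqrt (of_int ?D))\<^sup>2 = (of_int k' * (of_int N :: real))\<^sup>2"
    by (rule arg_cong)
  then have "of_int (?D * k\<^sup>2) = (of_int ((k' * N)\<^sup>2) :: real)"
    using D by (simp add: power_mult_distrib mult.commute del: of_int_diff of_int_add)
  then have "?D * k\<^sup>2 = (k' * N)\<^sup>2"
    unfolding of_int_eq_iff .
  moreover have "k \<noteq> 0"
    using k_real t \<open>N \<noteq> 0\<close> by auto
  ultimately show False
    using discriminant_not_square[OF r] by blast
qed

section \<open>Exclusion of state transfer for degree 0, degree 1 and degree at least 2\<close>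

context regular_pair_graph
begin

text \<open>By regularity the constant 1 is an eigenfunction of \<open>R R^T\<close> for
  \<open>2r\<close>; the lift takes the value \<open>2b\<close> on new vertices.\<close>

lemma Perron_lift:
  fixes b :: complex
  assumes "2 * of_nat r * b\<^sup>2 + (2 - 3 * of_nat r) * b - 1 = 0"
  shows "eigenfunction (Q_graph G) (of_nat r + b * (2 * of_nat r))
    (case_sum (\<lambda>u. 1) (\<lambda>e. b * vertex_sum (\<lambda>u. 1) e))"
proof (rule Q_eigen_lift)
  have "edge_sum (vertex_sum (\<lambda>u. 1)) = edge_sum (\<lambda>e. 2)"
    by (rule inc_sum_cong) (rule vertex_sum_1)
  then show "edge_sum (vertex_sum (\<lambda>u. 1)) u = 2 * of_nat r * 1" if "u \<in> pverts G" for u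
    using that by (simp add: edge_sum_const)
qed (use assms in \<open>simp add: algebra_simps\<close>)

text \<open>Without edges the indicator of \<open>u\<close> is an eigenfunction for 0 that is seen
  at \<open>u\<close> but not at \<open>v\<close>.\<close>

lemma no_PST_degree_0:
  assumes "r = 0" and uv: "u \<in> pverts (Q_graph G)" "u \<noteq> v"
    and z: "cmod z = 1"
    and transfer: "transfers (Q_graph G) t z u v"
  shows False
proof -
  note transferD = transfer[unfolded transfers_def, rule_format]
  have E: "edges G = {}"
  proof (rule ccontr)
    assume "edges G \<noteq> {}"
    then obtain e where e: "e \<in> edges G" by blast
    then obtain a where "a \<in> e" "a \<in> pverts G"
      by (auto elim: edgesE)
    then have "e \<in> {e \<in> edges G. a \<in> e}" "card {e \<in> edges G. a \<in> e} = 0"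
      using e card_edges_at assms(1) by auto
    then show False
      using finite_edges by auto
  qed
  obtain a where a: "u = Inl a" "a \<in> pverts G"
    using uv E by (auto simp: Q_verts)
  have "eigenfunction (Q_graph G) (of_nat r) (case_sum (\<lambda>x. of_bool (x = a)) (\<lambda>e. 0))"
    using E by (intro Q_eigen_old) auto
  from transferD[OF this] have "1 = z * case_sum (\<lambda>x. of_bool (x = a)) (\<lambda>e. 0) v"
    using a assms(1) by simp
  then show False
    using uv a by (auto split: sum.splits)
qed

text \<open>The Perron quadratic \<open>2 b^2 - b - 1\<close> has roots 1 and -1/2, with eigenvalues
  3 and 0. These give \<open>z = 1\<close>; an eigenfunction living on the path through
  \<open>u\<close> then separates \<open>u\<close> from \<open>v\<close>.\<close>

lemma no_PST_degree_1:
  assumes r: "r = 1" and u: "u \<in> pverts (Q_graph G)" and v: "v \<in> pverts (Q_graph G)"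
    and uv: "u \<noteq> v" and z: "cmod z = 1"
    and transfer: "transfers (Q_graph G) t z u v"
  shows False
proof -
  note transferD = transfer[unfolded transfers_def, rule_format]
  define J :: "complex \<Rightarrow> 'a + 'a set \<Rightarrow> complex" where
    "J b = case_sum (\<lambda>u. 1) (\<lambda>e. b * vertex_sum (\<lambda>u. 1) e)" for b
  have J: "J b (Inl a) = 1" "e \<in> edges G \<Longrightarrow> J b (Inr e) = 2 * b" for a e b
    by (simp_all add: J_def vertex_sum_1)
  have lo: "J (-1/2) u = z * J (-1/2) v"
    using transferD[OF Perron_lift[of "-1/2", folded J_def]] r
    by (simp add: power2_eq_square)
  have hi: "exp (- \<i> * complex_of_real t * 3) * J 1 u = z * J 1 v"
    using transferD[OF Perron_lift[of 1, folded J_def]] r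
    by (simp add: power2_eq_square)
  \<comment> \<open>\<open>J 1\<close> is 1 on old and 2 on new vertices, so \<open>u\<close> and
    \<open>v\<close> are of the same kind; \<open>J (-1/2)\<close> then agrees at both, which forces
    \<open>z = 1\<close>.\<close>
  have "cmod (J 1 u) = cmod (J 1 v)"
    using arg_cong[OF hi, of cmod] z by (simp add: norm_mult)
  with lo have z1: "z = 1"
    using u v by (auto simp: Q_verts J)
  show False
  proof (cases u)
    case (Inr e)
    then have e: "e \<in> edges G" using u by (auto simp: Q_verts)
    then obtain a b where ab: "e = {a, b}" "a \<noteq> b" "a \<in> pverts G" "b \<in> pverts G"
      by (rule edgesE)
    \<comment> \<open>The eigenfunction \<open>(1, -1, 1)\<close> for 0 on the path with centre
      \<open>e\<close>; it takes the value -1 at \<open>u\<close> only.\<close>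
    define f where "f = case_sum (\<lambda>x. of_bool (x \<in> e)) (\<lambda>e'. - of_bool (e' = e) :: complex)"
    have es: "edge_sum (\<lambda>e'. - of_bool (e' = e)) x = - of_bool (x \<in> e)" for x
    proof -
      have "edge_sum (\<lambda>e'. - of_bool (e' = e)) x
          = (\<Sum>e' | e' \<in> edges G \<and> x \<in> e'. if e' = e then - 1 else 0)"
        unfolding inc_sum_def by (intro sum.cong) auto
      then show ?thesis using e finite_edges by simp
    qed
    have "eigenfunction (Q_graph G) 0 f"
      unfolding f_def
    proof (rule Q_eigenI)
      show "of_nat r * of_bool (x \<in> e) + edge_sum (\<lambda>e'. - of_bool (e' = e)) x
          = 0 * of_bool (x \<in> e)" for x
        by (simp add: es r)
      have "edge_sum (\<lambda>e'. - of_bool (e' = e)) = (\<lambda>x. -1 * of_bool (x \<in> e))"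
        by (simp add: es fun_eq_iff)
      then have "vertex_sum (edge_sum (\<lambda>e'. - of_bool (e' = e))) e'
          = -1 * vertex_sum (\<lambda>x. of_bool (x \<in> e)) e'" for e'
        by (simp only: inc_sum_scale)
      then show "(2 * of_nat r - 2) * - of_bool (e' = e) + vertex_sum (\<lambda>x. of_bool (x \<in> e)) e'
          + vertex_sum (edge_sum (\<lambda>e'. - of_bool (e' = e))) e' = 0 * - of_bool (e' = e)" for e'
        by (simp add: r)
    qed
    from transferD[OF this] have "f u = f v"
      using z1 by simp
    moreover have "f u = - 1"
      using Inr by (simp add: f_def)
    ultimately show False
      using Inr uv by (cases v) (auto simp: f_def of_bool_def split: if_splits)
  next
    case (Inl a)
    then have a: "a \<in> pverts G" using u by (auto simp: Q_verts)
    have "card {e \<in> edges G. a \<in> e} = 1"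
      using card_edges_at[OF a] r by simp
    then obtain e where e: "{e \<in> edges G. a \<in> e} = {e}"
      using card_1_singletonE by blast
    then have "e \<in> edges G" "a \<in> e" by auto
    then obtain b where b: "e = {a, b}" "a \<noteq> b" "b \<in> pverts G"
      by (auto elim!: edgesE)
    have "card {e \<in> edges G. b \<in> e} = 1"
      using card_edges_at[OF b(3)] r by simp
    then obtain e' where e': "{e \<in> edges G. b \<in> e} = {e'}"
      using card_1_singletonE by blast
    moreover have "e \<in> {e \<in> edges G. b \<in> e}"
      using \<open>e \<in> edges G\<close> b(1) by simp
    ultimately have eb: "{e \<in> edges G. b \<in> e} = {e}"
      by simp
    \<comment> \<open>The eigenfunction \<open>(1, 0, -1)\<close> for 1 on the path with ends
      \<open>a\<close> and \<open>b\<close>; it takes the value 1 at \<open>a\<close> only.\<close>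
    define x where "x w = (of_bool (w = a) - of_bool (w = b) :: complex)" for w
    have "vertex_sum x e' = 0" if e': "e' \<in> edges G" for e'
    proof (cases "e' = e")
      case True
      then show ?thesis
        using that b by (simp add: vertex_sum_edge x_def)
    next
      case False
      then have "a \<notin> e'" "b \<notin> e'"
        using e eb e' by auto
      then show ?thesis
        by (auto simp: inc_sum_def x_def intro!: sum.neutral)
    qed
    note eig = Q_eigen_old[OF this]
    have "exp (- 2 * \<i> * complex_of_real t * of_nat r) = z\<^sup>2"
      by (rule Q.transfer_phase[OF transfer z eig]) (use Inl b in \<open>auto simp: x_def\<close>)
    then have two: "exp (- 2 * \<i> * complex_of_real t) = 1"
      using z1 r by simp
    have "J 1 u = J 1 v"
      using lo z1 u v by (auto simp: Q_verts J)
    moreover have "J 1 u \<noteq> 0"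
      using Inl J by simp
    ultimately have three: "exp (- \<i> * complex_of_real t * 3) = 1"
      using hi z1 by simp
    \<comment> \<open>The eigenvalues give the exponents 2 and 3, which are coprime, so the phase
      for eigenvalue 1 is trivial.\<close>
    have "exp (- \<i> * complex_of_real t)
        = exp (- \<i> * complex_of_real t * 3) / exp (- 2 * \<i> * complex_of_real t)"
      by (simp flip: exp_diff)
    then have "exp (- \<i> * complex_of_real t) = 1"
      using two three by simp
    then have "x a = case_sum x (\<lambda>e. 0) v"
      using transferD[OF eig] Inl z1 r by simp
    then show False
      using Inl uv b by (auto simp: x_def of_bool_def split: sum.splits if_splits)
  qed
qed

lemma no_PST_degree_ge_2:
  fixes t :: real
  assumes r: "r \<ge> 2" and u: "u \<in> pverts (Q_graph G)" and t: "t \<noteq> 0" and z: "cmod z = 1"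
    and transfer: "transfers (Q_graph G) t z u v"
    and ints: "\<And>\<mu>::complex. eigenvalue (signless_laplacian G) \<mu> \<Longrightarrow> \<mu> \<in> \<int>"
  shows False
proof -
  \<comment> \<open>The root of the discriminant of the Perron quadratic, equal to
    \<open>\<theta>\<^sub>+ - \<theta>\<^sub>-\<close>.\<close>
  define s where "s = sqrt (of_int (9 * (int r)\<^sup>2 - 4 * int r + 4))"
  have "int r * 1 \<le> int r * int r"
    using r by (intro mult_left_mono) auto
  then have "9 * (int r)\<^sup>2 - 4 * int r + 4 \<ge> 0"
    unfolding power2_eq_square using r by linarith
  then have s2: "s\<^sup>2 = 9 * (real r)\<^sup>2 - 4 * real r + 4"
    unfolding s_def by (subst real_sqrt_pow2) (simp_all flip: of_int_0_le_iff[where ?'a = real])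
  have s2c: "(complex_of_real s)\<^sup>2 = 9 * (of_nat r)\<^sup>2 - 4 * of_nat r + 4"
    unfolding of_real_power[symmetric] s2 by simp
  have r0: "(of_nat r :: complex) \<noteq> 0"
    using r by simp
  define J :: "complex \<Rightarrow> 'a + 'a set \<Rightarrow> complex" where
    "J b = case_sum (\<lambda>u. 1) (\<lambda>e. b * vertex_sum (\<lambda>u. 1) e)" for b
  define bp where "bp = (3 * of_nat r - 2 + complex_of_real s) / (4 * of_nat r)"
  define bm where "bm = (3 * of_nat r - 2 - complex_of_real s) / (4 * of_nat r)"
  have quad: "2 * of_nat r * ((3 * of_nat r - 2 + \<sigma>) / (4 * of_nat r))\<^sup>2
      + (2 - 3 * of_nat r) * ((3 * of_nat r - 2 + \<sigma>) / (4 * of_nat r)) - 1 = 0"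
    if "\<sigma>\<^sup>2 = 9 * (of_nat r)\<^sup>2 - 4 * of_nat r + 4" for \<sigma> :: complex
  proof -
    have "2 * of_nat r * ((3 * of_nat r - 2 + \<sigma>) / (4 * of_nat r))\<^sup>2
        + (2 - 3 * of_nat r) * ((3 * of_nat r - 2 + \<sigma>) / (4 * of_nat r)) - 1
        = (\<sigma>\<^sup>2 - (9 * (of_nat r)\<^sup>2 - 4 * of_nat r + 4)) / (8 * of_nat r)"
      using r0 by (simp add: field_simps power2_eq_square)
    then show ?thesis
      using that by simp
  qed
  have bp: "2 * of_nat r * bp\<^sup>2 + (2 - 3 * of_nat r) * bp - 1 = 0"
    unfolding bp_def by (rule quad[OF s2c])
  have bm: "2 * of_nat r * bm\<^sup>2 + (2 - 3 * of_nat r) * bm - 1 = 0"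
    unfolding bm_def using quad[of "- complex_of_real s"] s2c by simp
  note Jp = Perron_lift[OF bp, folded J_def] and Jm = Perron_lift[OF bm, folded J_def]
  \<comment> \<open>The constant term -1 excludes the root 0, so both Perron lifts vanish
    nowhere.\<close>
  have "bp \<noteq> 0" "bm \<noteq> 0"
    using bp bm by auto
  then have Ju: "J bp u \<noteq> 0" "J bm u \<noteq> 0"
    using u by (auto simp: J_def Q_verts vertex_sum_1)
  have sum_pm: "bp * (2 * of_nat r) + bm * (2 * of_nat r) = 3 * of_nat r - 2"
    and diff_pm: "bp * (2 * of_nat r) - bm * (2 * of_nat r) = complex_of_real s"
    using r0 by (simp_all add: bp_def bm_def field_simps)
  obtain k0 where "complex_of_real t *
      (of_nat r + bp * (2 * of_nat r) - (of_nat r + bm * (2 * of_nat r))) = of_int k0 * of_real pi"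
    by (rule Q.transfer_eigenvalue_difference[OF transfer z Jp Ju(1) Jm Ju(2)])
  then have "complex_of_real (t * s) = of_real (of_int k0 * pi)"
    using diff_pm by simp
  then have k0: "t * s = of_int k0 * pi"
    unfolding of_real_eq_iff .
  \<comment> \<open>Adding the differences of both Perron eigenvalues to \<open>\<tau>\<close>
    removes \<open>s\<close>, as their sum is \<open>5r - 2\<close>.\<close>
  have support: "\<exists>k::int. complex_of_real t * (5 * of_nat r - 2 - 2 * \<tau>) = of_int k * of_real pi"
    if f: "eigenfunction (Q_graph G) \<tau> f" "f u \<noteq> 0"
    for f \<tau>
  proof -
    obtain k1 where k1: "complex_of_real t * (of_nat r + bp * (2 * of_nat r) - \<tau>) = of_int k1 * of_real pi"
      by (rule Q.transfer_eigenvalue_difference[OF transfer z Jp Ju(1) f])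
    obtain k2 where k2: "complex_of_real t * (of_nat r + bm * (2 * of_nat r) - \<tau>) = of_int k2 * of_real pi"
      by (rule Q.transfer_eigenvalue_difference[OF transfer z Jm Ju(2) f])
    have "5 * of_nat r - 2 - 2 * \<tau>
        = (of_nat r + bp * (2 * of_nat r) - \<tau>) + (of_nat r + bm * (2 * of_nat r) - \<tau>)"
      using sum_pm by (simp add: algebra_simps)
    then have "complex_of_real t * (5 * of_nat r - 2 - 2 * \<tau>) = of_int (k1 + k2) * of_real pi"
      using k1 k2 by (simp only: distrib_left of_int_add distrib_right)
    then show ?thesis by blast
  qed
  have int_zero: "N = 0" if "complex_of_real t * of_int N = of_int k * of_real pi" for N k
    using r by (intro commensurable_with_discriminant_eq_0[OF _ t that k0[unfolded s_def]]) simp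
  \<comment> \<open>Summing \<open>support\<close> over both lifts of \<open>\<mu>\<close> leaves
    the integer \<open>4r - 2 \<mu>\<close>, which \<open>int_zero\<close> forces to vanish.\<close>
  have nonzero: "\<mu> = 2 * of_nat r"
    if x: "\<And>a. a \<in> pverts G \<Longrightarrow> edge_sum (vertex_sum x) a = \<mu> * x a"
      and \<mu>: "\<mu> \<noteq> 0" "\<mu> \<in> \<int>"
      and xu: "\<And>b. b \<noteq> 0 \<Longrightarrow> case_sum x (\<lambda>e. b * vertex_sum x e) u \<noteq> 0" for x and \<mu> :: complex
  proof -
    define p where "p = [:- 1, 2 - of_nat r - \<mu>, \<mu>:]"
    have "degree p \<noteq> 0"
      using \<mu>(1) by (simp add: p_def)
    then obtain b where "poly p b = 0"
      using fundamental_theorem_of_algebra[of p] by (auto simp: constant_degree)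
    then have b: "\<mu> * b\<^sup>2 + (2 - of_nat r - \<mu>) * b - 1 = 0"
      by (simp add: p_def power2_eq_square algebra_simps)
    \<comment> \<open>The second root of the quadratic, by Vieta.\<close>
    define b' where "b' = (of_nat r + \<mu> - 2) / \<mu> - b"
    have sum: "b * \<mu> + b' * \<mu> = of_nat r + \<mu> - 2"
      using \<mu>(1) by (simp add: b'_def field_simps)
    have "b' * (\<mu> * b' + (2 - of_nat r - \<mu>)) = b * (\<mu> * b + (2 - of_nat r - \<mu>))"
    proof -
      have "\<mu> * b' + (2 - of_nat r - \<mu>) = - (\<mu> * b)" "\<mu> * b + (2 - of_nat r - \<mu>) = - (\<mu> * b')"
        using sum by (simp_all add: algebra_simps)
      then show ?thesis by simp
    qed
    then have b': "\<mu> * b'\<^sup>2 + (2 - of_nat r - \<mu>) * b' - 1 = 0"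
      using b by (simp add: power2_eq_square algebra_simps)
    have "b \<noteq> 0" "b' \<noteq> 0"
      using b b' by auto
    note nz = xu[OF this(1)] xu[OF this(2)]
    obtain k1 :: int where
      k1: "complex_of_real t * (5 * of_nat r - 2 - 2 * (of_nat r + b * \<mu>)) = of_int k1 * of_real pi"
      using support[OF Q_eigen_lift[OF x b] nz(1)] by blast
    obtain k2 :: int where
      k2: "complex_of_real t * (5 * of_nat r - 2 - 2 * (of_nat r + b' * \<mu>)) = of_int k2 * of_real pi"
      using support[OF Q_eigen_lift[OF x b'] nz(2)] by blast
    obtain m where m: "\<mu> = of_int m"
      using \<mu>(2) by (rule Ints_cases)
    have "(5 * of_nat r - 2 - 2 * (of_nat r + b * \<mu>)) + (5 * of_nat r - 2 - 2 * (of_nat r + b' * \<mu>))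
        = 6 * of_nat r - 4 - 2 * (b * \<mu> + b' * \<mu>)"
      by (simp add: algebra_simps)
    also have "\<dots> = of_int (4 * int r - 2 * m)"
      unfolding sum by (simp add: m algebra_simps)
    finally have "complex_of_real t * of_int (4 * int r - 2 * m)
        = complex_of_real t * (5 * of_nat r - 2 - 2 * (of_nat r + b * \<mu>))
        + complex_of_real t * (5 * of_nat r - 2 - 2 * (of_nat r + b' * \<mu>))"
      by (simp only: distrib_left[symmetric])
    also have "\<dots> = of_int (k1 + k2) * of_real pi"
      by (simp only: k1 k2 of_int_add distrib_right)
    finally have "complex_of_real t * of_int (4 * int r - 2 * m) = of_int (k1 + k2) * of_real pi" .
    then have "4 * int r - 2 * m = 0"
      by (rule int_zero)
    then have "m = 2 * int r" by simp
    then show ?thesis using m by simp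
  qed
  have ev_int: "\<mu> \<in> \<int>"
    if "\<And>a. a \<in> pverts G \<Longrightarrow> edge_sum (vertex_sum x) a = \<mu> * x a" "a \<in> pverts G" "x a \<noteq> 0"
    for x a and \<mu> :: complex
    using that by (intro ints eigenvalue_of_eigenfunction[of \<mu> x a])
      (simp_all add: eigenfunction_def signless_laplacian_op_incidence)
  show False
  proof (cases u)
    case (Inl a)
    then have a: "a \<in> pverts G" using u by (auto simp: Q_verts)
    \<comment> \<open>The diagonal entry of \<open>R R^T\<close> at \<open>a\<close> is
      \<open>r\<close>, so some eigenvalue other than \<open>2r\<close> is seen there.\<close>
    have "card {e \<in> edges G. a \<in> e} \<noteq> 2 * r"
      using card_edges_at[OF a] r by simp
    from gram_eigenfunction_in_support[where I = "\<lambda>u e. u \<in> e",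
        OF pair_finite_verts finite_edges a this]
    obtain x and \<mu> :: complex where
      x: "\<And>a. a \<in> pverts G \<Longrightarrow> edge_sum (vertex_sum x) a = \<mu> * x a" "x a \<noteq> 0"
      and \<mu>: "\<mu> \<noteq> of_nat (2 * r)"
      and ker: "\<And>e. \<mu> = 0 \<Longrightarrow> e \<in> edges G \<Longrightarrow> vertex_sum x e = 0"
      by blast
    show False
    proof (cases "\<mu> = 0")
      case True
      have "case_sum x (\<lambda>e. 0) u \<noteq> 0"
        using Inl x(2) by simp
      then obtain k :: int where
        "complex_of_real t * (5 * of_nat r - 2 - 2 * of_nat r) = of_int k * of_real pi"
        using support[OF Q_eigen_old[OF ker[OF True]]] by blast
      then have "complex_of_real t * of_int (3 * int r - 2) = of_int k * of_real pi"
        by (simp add: algebra_simps)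
      then have "3 * int r - 2 = 0"
        by (rule int_zero)
      then show False using r by simp
    next
      case False
      then have "\<mu> = 2 * of_nat r"
        using nonzero[OF x(1) False ev_int[OF x(1) a x(2)]] Inl x(2) by simp
      then show False using \<mu> by simp
    qed
  next
    case (Inr e)
    then have e: "e \<in> edges G" using u by (auto simp: Q_verts)
    obtain a b where ab: "e = {a, b}" "a \<noteq> b" "a \<in> pverts G" "b \<in> pverts G"
      using edgesE[OF e] by metis
    then have "{u \<in> pverts G. u \<in> e} = {a, b}" by auto
    \<comment> \<open>The diagonal entry of \<open>R^T R\<close> at \<open>e\<close> is 2, which
      differs from \<open>2r\<close> as \<open>r \<ge> 2\<close>.\<close>
    then have "card {u \<in> pverts G. u \<in> e} \<noteq> 2 * r"
      using ab r by simp
    from gram_eigenfunction_in_support[where I = "\<lambda>e u. u \<in> e",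
        OF finite_edges pair_finite_verts e this]
    obtain y and \<mu> :: complex where
      y: "\<And>e. e \<in> edges G \<Longrightarrow> vertex_sum (edge_sum y) e = \<mu> * y e" "y e \<noteq> 0"
      and \<mu>: "\<mu> \<noteq> of_nat (2 * r)"
      and ker: "\<And>u. \<mu> = 0 \<Longrightarrow> u \<in> pverts G \<Longrightarrow> edge_sum y u = 0"
      by blast
    show False
    proof (cases "\<mu> = 0")
      case True
      have "case_sum (\<lambda>u. 0) y u \<noteq> 0"
        using Inr y(2) by simp
      then obtain k :: int where
        "complex_of_real t * (5 * of_nat r - 2 - 2 * (2 * of_nat r - 2)) = of_int k * of_real pi"
        using support[OF Q_eigen_new[OF ker[OF True]]] by blast
      then have "complex_of_real t * of_int (int r + 2) = of_int k * of_real pi"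
        by (simp add: algebra_simps)
      then have "int r + 2 = 0"
        by (rule int_zero)
      then show False by simp
    next
      case False
      \<comment> \<open>\<open>R y\<close> is an eigenfunction of \<open>R R^T\<close> for the same
        \<open>\<mu>\<close>, and its lift takes the nonzero value \<open>b \<mu> y e\<close> at the
        new vertex \<open>e\<close>.\<close>
      let ?x = "edge_sum y"
      have "edge_sum (vertex_sum ?x) = edge_sum (\<lambda>e. \<mu> * y e)"
        by (rule inc_sum_cong) (rule y(1))
      then have x: "edge_sum (vertex_sum ?x) a = \<mu> * ?x a" for a
        by (simp add: inc_sum_scale)
      have ye: "vertex_sum ?x e \<noteq> 0"
        using y e False by simp
      then have "?x a \<noteq> 0 \<or> ?x b \<noteq> 0"
        using ab e vertex_sum_edge[of a b ?x] by auto
      then have "\<mu> \<in> \<int>"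
        using ev_int[OF x] ab by blast
      then have "\<mu> = 2 * of_nat r"
        using nonzero[OF x False] Inr ye by simp
      then show False using \<mu> by simp
    qed
  qed
qed

end

theorem theorem4p2:
  fixes G :: "'a pair_pre_digraph" and r n m :: nat
  assumes "pair_graph G"
    and "Digraph_Component.connected (with_proj G)"
    and "regular r G"
    and "card (pverts G) = n" and "n \<ge> 2"
    and "card (edges G) = m"
    and "\<And>\<mu>::complex. eigenvalue (signless_laplacian G) \<mu> \<Longrightarrow> \<mu> \<in> \<int>"
  shows "\<not> has_signless_laplacian_PST (Q_graph G)"
proof
  interpret regular_pair_graph G r
    using assms(1,3) by (simp add: regular_pair_graph_def regular_pair_graph_axioms_def)
  assume "has_signless_laplacian_PST (Q_graph G)"
  then obtain u v where uv: "u \<in> pverts (Q_graph G)" "v \<in> pverts (Q_graph G)" "u \<noteq> v"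
    and PST: "signless_laplacian_PST (Q_graph G) u v"
    unfolding has_signless_laplacian_PST_def by blast
  obtain t z where z: "cmod z = 1" and
    eq: "mat_exp ((- \<i> * complex_of_real t) \<cdot>\<^sub>m signless_laplacian (Q_graph G))
      *\<^sub>v char_vec (Q_graph G) u = z \<cdot>\<^sub>v char_vec (Q_graph G) v"
    using PST unfolding signless_laplacian_PST_def by blast
  note t = Q.PST_time_nonzero[OF eq uv(1,3)] and transfer = Q.transfersI[OF eq uv(1,2)]
  \<comment> \<open>The discriminant is 4 for \<open>r = 0\<close> and 9 for \<open>r = 1\<close>,
    both squares, so irrationality is available only from \<open>r = 2\<close> on.\<close>
  consider "r = 0" | "r = 1" | "r \<ge> 2" by linarith
  then show False
  proof cases
    case 1
    then show False by (rule no_PST_degree_0[OF _ uv(1,3) z transfer])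
  next
    case 2
    then show False by (rule no_PST_degree_1[OF _ uv z transfer])
  next
    case 3
    then show False by (rule no_PST_degree_ge_2[OF _ uv(1) t z transfer assms(7)])
  qed
qed

end
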